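(* With the sum taken over all integers $n,d,k$, \[ \sum_{n,d,k} \left\langle {n \atop d} \right\rangle_k x^d y^k \frac{z^n}{n!} = \frac{1}{\theta} \int_\theta^{\theta^y} \frac{dt}{x - t^{1-1/y}}, \qquad\text{where } \theta = \exp\left\{\frac{1-x}{y^{-1}-1}\, z\right\}. \]
   Context: $S_n$ is the set of permutations of $\{1,\dots,n\}$. A descent of $\pi\in S_n$ is an index $i$ with $1\le i\le n-1$ and $\pi(i)>\pi(i+1)$; $\mathrm{Des}(\pi)$ is the number of descents. For integers $n,d,k$, $\left\langle {n \atop d} \right\rangle_k$ is the number of $\pi\in S_n$ with $\mathrm{Des}(\pi)=d$ and $\pi(1)=k$; it is $0$ whenever no such permutation exists (in particular for $n\le 0$, for $k<1$ or $k>n$, and for $d<0$ or $d\ge n$). The identity is understood for $x,y,z$ where both sides are defined. *)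

theory Defs
  imports "HOL-Analysis.Analysis" "HOL-Combinatorics.Permutations"
begin

definition Des :: "int \<Rightarrow> (int \<Rightarrow> int) \<Rightarrow> nat" where
  "Des n \<pi> = card {i. 1 \<le> i \<and> i \<le> n - 1 \<and> \<pi> i > \<pi> (i + 1)}"

text \<open>
  The condition \<open>0 < n\<close> is not redundant: the identity function permutes the empty set
  \<open>{1..n}\<close> when \<open>n \<le> 0\<close>, but an empty permutation has no first value.
\<close>

definition eulerian_first :: "int \<Rightarrow> int \<Rightarrow> int \<Rightarrow> nat" where
  "eulerian_first n d k =
     card {\<pi>. 0 < n \<and> \<pi> permutes {1..n} \<and> int (Des n \<pi>) = d \<and> \<pi> 1 = k}"

text \<open>
  The summand vanishes unless \<open>n \<ge> 1\<close>, \<open>d \<ge> 0\<close> and \<open>k \<ge> 1\<close>, so the values of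
  \<open>powi\<close> at negative exponents and of \<open>fact (nat n)\<close> at negative \<open>n\<close> never contribute.
\<close>

definition eulerian_first_term :: "real \<Rightarrow> real \<Rightarrow> real \<Rightarrow> int \<times> int \<times> int \<Rightarrow> real" where
  "eulerian_first_term x y z = (\<lambda>(n, d, k).
     real (eulerian_first n d k) * x powi d * y powi k * (z powi n / fact (nat n)))"

end

theory Submission imports Defs begin

text \<open>
  Let \<open>P(n, k)\<close> be the sum of \<open>x\<close> to the number of descents over the permutations of
  \<open>{1..n}\<close> starting with \<open>k\<close>, \<open>B\<^sub>n = \<Sum>\<^sub>k P(n, k)\<close> with \<open>B\<^sub>0 = 1\<close>, and \<open>A\<^sub>n(y) = \<Sum>\<^sub>k P(n, k) y\<^sup>k\<close>.
  Deleting the first value gives \<open>P(n + 1, k + 1) - P(n + 1, k) = (x - 1) P(n, k)\<close>, with boundary values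
  \<open>P(n + 1, 1) = B\<^sub>n\<close> and \<open>P(n + 1, n + 1) = x B\<^sub>n\<close> (the latter for \<open>n \<ge> 1\<close>). Summing the differences
  from one end to the other yields \<open>B(s) (x - exp ((x - 1) s)) = x - 1\<close> for the exponential
  generating function \<open>B\<close>, and summation by parts yields a linear differential equation for that
  of \<open>A\<^sub>n(y)\<close> in terms of \<open>B(s)\<close> and \<open>B(y s)\<close>. Multiplied by the integrating factor
  \<open>exp (a s)\<close>, where \<open>a = (1 - x) / (1 / y - 1)\<close>, its solution is \<open>Q(y s) - Q(s)\<close> with
  \<open>Q'(w) = a exp (a w) / (x - exp ((x - 1) w))\<close>; substituting \<open>t = exp (a w)\<close> gives the integral.

  The equation for \<open>B\<close> also shows that \<open>x - exp ((x - 1) w)\<close> has no zero wherever \<open>B\<close> converges.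
  Convergence of \<open>B\<close> on the discs of radius \<open>|z|\<close> and \<open>|y z|\<close> comes from summability of the triple
  series, by retaining only the permutations that start with \<open>1\<close> or with \<open>n\<close>
  (the latter have weight zero if \<open>x = 0\<close>, but then \<open>B\<^sub>n = 1\<close>).
\<close>

section \<open>Deleting the first value of a permutation\<close>

text \<open>At \<open>n = 0\<close> the identity makes \<open>first_value_poly x 0 1\<close> equal
  to 1; the later sums over \<open>{1..n}\<close> exclude this stray value.\<close>

definition first_value_poly :: "real \<Rightarrow> nat \<Rightarrow> nat \<Rightarrow> real" where
  "first_value_poly x n k =
     (\<Sum>\<pi> | \<pi> permutes {1..int n} \<and> \<pi> 1 = int k. x ^ Des (int n) \<pi>)"

text \<open>This is the increasing bijection from the integers onto the integers other than
  \<open>k\<close>; \<open>unskip_value\<close> inverts it there.\<close>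

definition skip_value :: "int \<Rightarrow> int \<Rightarrow> int" where
  "skip_value k v = (if v < k then v else v + 1)"

definition unskip_value :: "int \<Rightarrow> int \<Rightarrow> int" where
  "unskip_value k v = (if v < k then v else v - 1)"

text \<open>The identity outside \<open>{1..n + 1}\<close> is what \<open>permutes\<close>
  demands.\<close>

definition prepend_value :: "int \<Rightarrow> int \<Rightarrow> (int \<Rightarrow> int) \<Rightarrow> int \<Rightarrow> int" where
  "prepend_value n k \<sigma> i =
     (if i = 1 then k else if 2 \<le> i \<and> i \<le> n + 1 then skip_value k (\<sigma> (i - 1)) else i)"

definition drop_first_value :: "int \<Rightarrow> int \<Rightarrow> (int \<Rightarrow> int) \<Rightarrow> int \<Rightarrow> int" where
  "drop_first_value n k \<pi> i =
     (if 1 \<le> i \<and> i \<le> n then unskip_value k (\<pi> (i + 1)) else i)"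

lemma permutes_intervalI:
  fixes p :: "int \<Rightarrow> int"
  assumes "inj_on p {a..b}" "p ` {a..b} \<subseteq> {a..b}" "\<And>i. i \<notin> {a..b} \<Longrightarrow> p i = i"
  shows "p permutes {a..b}"
proof (rule bij_imp_permutes)
  show "bij_betw p {a..b} {a..b}"
    unfolding bij_betw_def using assms endo_inj_surj[of "{a..b}" p] by simp
qed (use assms in auto)

lemma permutes_interval_range:
  fixes p :: "int \<Rightarrow> int"
  assumes "p permutes {a..b}" "a \<le> i" "i \<le> b"
  shows "a \<le> p i" "p i \<le> b"
  using permutes_in_image[OF assms(1), of i] assms(2,3) by auto

lemma prepend_value_permutes:
  assumes \<sigma>: "\<sigma> permutes {1..n}" and k: "1 \<le> k" "k \<le> n + 1" and n: "1 \<le> n"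
  shows "prepend_value n k \<sigma> permutes {1..n + 1}"
proof (rule permutes_intervalI)
  have inj: "\<sigma> i = \<sigma> j \<longleftrightarrow> i = j" for i j
    using permutes_inj[OF \<sigma>] by (auto simp: inj_def)
  show "inj_on (prepend_value n k \<sigma>) {1..n + 1}"
    by (rule inj_onI) (auto simp: prepend_value_def skip_value_def inj split: if_splits)
  show "prepend_value n k \<sigma> ` {1..n + 1} \<subseteq> {1..n + 1}"
  proof (rule image_subsetI)
    fix i assume i: "i \<in> {1..n + 1}"
    show "prepend_value n k \<sigma> i \<in> {1..n + 1}"
      using i k permutes_interval_range[OF \<sigma>, of "i - 1"]
      by (auto simp: prepend_value_def skip_value_def)
  qed
qed (use n in \<open>auto simp: prepend_value_def\<close>)

lemma drop_first_value_permutes: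
  assumes \<pi>: "\<pi> permutes {1..n + 1}" and k: "\<pi> 1 = k" and n: "1 \<le> n"
  shows "drop_first_value n k \<pi> permutes {1..n}"
proof (rule permutes_intervalI)
  have inj: "\<pi> i = \<pi> j \<longleftrightarrow> i = j" for i j
    using permutes_inj[OF \<pi>] by (auto simp: inj_def)
  have k_bounds: "1 \<le> k" "k \<le> n + 1"
    using permutes_interval_range[OF \<pi>, of 1] n k by auto
  have ne: "\<pi> (i + 1) \<noteq> k" if "1 \<le> i" for i
    using inj[of "i + 1" 1] k that by auto
  show "inj_on (drop_first_value n k \<pi>) {1..n}"
  proof (rule inj_onI)
    fix i j assume "i \<in> {1..n}" "j \<in> {1..n}" "drop_first_value n k \<pi> i = drop_first_value n k \<pi> j"
    then show "i = j"
      using ne[of i] ne[of j] inj[of "i + 1" "j + 1"]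
      by (auto simp: drop_first_value_def unskip_value_def split: if_splits)
  qed
  show "drop_first_value n k \<pi> ` {1..n} \<subseteq> {1..n}"
  proof (rule image_subsetI)
    fix i assume i: "i \<in> {1..n}"
    show "drop_first_value n k \<pi> i \<in> {1..n}"
      using i k_bounds ne[of i] permutes_interval_range[OF \<pi>, of "i + 1"]
      by (auto simp: drop_first_value_def unskip_value_def)
  qed
qed (auto simp: drop_first_value_def)

lemma drop_first_prepend_value:
  assumes "\<sigma> permutes {1..n}"
  shows "drop_first_value n k (prepend_value n k \<sigma>) = \<sigma>"
proof
  fix i
  show "drop_first_value n k (prepend_value n k \<sigma>) i = \<sigma> i"
    using permutes_not_in[OF assms, of i]
    by (auto simp: drop_first_value_def prepend_value_def skip_value_def unskip_value_def)
qed

lemma prepend_drop_first_value: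
  assumes \<pi>: "\<pi> permutes {1..n + 1}" and k: "\<pi> 1 = k"
  shows "prepend_value n k (drop_first_value n k \<pi>) = \<pi>"
proof
  fix i
  have "\<pi> i \<noteq> k" if "i \<noteq> 1"
    using permutes_inj[OF \<pi>] k that by (auto simp: inj_def)
  then show "prepend_value n k (drop_first_value n k \<pi>) i = \<pi> i"
    using permutes_not_in[OF \<pi>, of i] k
    by (auto simp: drop_first_value_def prepend_value_def skip_value_def unskip_value_def)
qed

text \<open>Relabelling by \<open>skip_value\<close> is increasing, so the old descents survive,
  shifted by one. The only new adjacent pair is at position 1, and it descends exactly when
  \<open>\<sigma> 1 < k\<close>.\<close>

lemma Des_prepend_value:
  assumes n: "1 \<le> n"
  shows "Des (n + 1) (prepend_value n k \<sigma>) = (if \<sigma> 1 < k then 1 else 0) + Des n \<sigma>"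
proof -
  let ?D = "{i. 1 \<le> i \<and> i \<le> n - 1 \<and> \<sigma> i > \<sigma> (i + 1)}"
  have fin: "finite ?D"
    by (rule finite_subset[of _ "{1..n}"]) auto
  have eq: "{i. 1 \<le> i \<and> i \<le> n + 1 - 1 \<and> prepend_value n k \<sigma> i > prepend_value n k \<sigma> (i + 1)}
      = (if \<sigma> 1 < k then {1} else {}) \<union> (\<lambda>i. i + 1) ` ?D" (is "?L = ?R")
  proof (rule set_eqI)
    fix i
    have "i \<in> (\<lambda>i. i + 1) ` ?D \<longleftrightarrow> i - 1 \<in> ?D"
      by (metis (no_types, lifting) add_diff_cancel_right' diff_add_cancel image_iff)
    then show "i \<in> ?L \<longleftrightarrow> i \<in> ?R"
      using n by (cases "i = 1") (auto simp: prepend_value_def skip_value_def)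
  qed
  have "card ((\<lambda>i. i + 1) ` ?D) = card ?D"
    by (rule card_image) auto
  moreover have "1 \<notin> (\<lambda>i. i + 1) ` ?D" by auto
  ultimately show ?thesis
    unfolding Des_def eq using fin by simp
qed

text \<open>Deleting the first value is a bijection onto the permutations of \<open>{1..n}\<close>;
  these are then grouped by their own first value \<open>j\<close>, and a factor \<open>x\<close>
  records the descent from \<open>k\<close> to a smaller \<open>j\<close>.\<close>

lemma first_value_poly_Suc:
  assumes n: "1 \<le> n" and k: "1 \<le> k" "k \<le> n + 1"
  shows "first_value_poly x (n + 1) k =
    (\<Sum>j=1..n. (if j < k then x else 1) * first_value_poly x n j)"
proof -
  let ?S = "{\<sigma>. \<sigma> permutes {1..int n}}"
  let ?w = "\<lambda>\<sigma>. (if \<sigma> 1 < int k then x else 1) * x ^ Des (int n) \<sigma>"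
  have "first_value_poly x (n + 1) k = (\<Sum>\<sigma>\<in>?S. ?w \<sigma>)"
    unfolding first_value_poly_def of_nat_add of_nat_1
  proof (rule sum.reindex_bij_witness[where i = "prepend_value (int n) (int k)"
        and j = "drop_first_value (int n) (int k)"])
    fix \<pi> assume \<pi>: "\<pi> \<in> {\<pi>. \<pi> permutes {1..int n + 1} \<and> \<pi> 1 = int k}"
    then show inv: "prepend_value (int n) (int k) (drop_first_value (int n) (int k) \<pi>) = \<pi>"
      by (intro prepend_drop_first_value) auto
    show "drop_first_value (int n) (int k) \<pi> \<in> ?S"
      using \<pi> n by (auto intro!: drop_first_value_permutes)
    show "?w (drop_first_value (int n) (int k) \<pi>) = x ^ Des (int n + 1) \<pi>"
      using Des_prepend_value[of "int n" "int k" "drop_first_value (int n) (int k) \<pi>"] n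
      by (auto simp: inv)
  next
    fix \<sigma> assume \<sigma>: "\<sigma> \<in> ?S"
    then show "drop_first_value (int n) (int k) (prepend_value (int n) (int k) \<sigma>) = \<sigma>"
      by (intro drop_first_prepend_value) auto
    show "prepend_value (int n) (int k) \<sigma> \<in> {\<pi>. \<pi> permutes {1..int n + 1} \<and> \<pi> 1 = int k}"
      using \<sigma> n k prepend_value_permutes[of \<sigma> "int n" "int k"] by (auto simp: prepend_value_def)
  qed
  also have "\<dots> = (\<Sum>j=1..n. \<Sum>\<sigma> | \<sigma> \<in> ?S \<and> nat (\<sigma> 1) = j. ?w \<sigma>)"
  proof (intro sum.group[symmetric] image_subsetI)
    fix \<sigma> assume "\<sigma> \<in> ?S"
    then show "nat (\<sigma> 1) \<in> {1..n}"
      using permutes_interval_range[of \<sigma> 1 "int n" 1] n by auto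
  qed (auto simp: finite_permutations)
  also have "\<dots> = (\<Sum>j=1..n. (if j < k then x else 1) * first_value_poly x n j)"
    unfolding first_value_poly_def sum_distrib_left
    by (intro sum.cong) auto
  finally show ?thesis .
qed

lemma first_value_poly_1: "first_value_poly x 1 1 = 1"
proof -
  have "{\<pi>. \<pi> permutes {1..int 1} \<and> \<pi> 1 = int 1} = {id}"
    by auto
  then show ?thesis
    by (simp add: first_value_poly_def Des_def)
qed

section \<open>Recurrences for the descent polynomials\<close>

text \<open>The value 1 at \<open>n = 0\<close> makes \<open>first_value_poly_Suc_first\<close> hold
  there as well.\<close>

definition descent_poly :: "real \<Rightarrow> nat \<Rightarrow> real" where
  "descent_poly x n = (if n = 0 then 1 else \<Sum>k=1..n. first_value_poly x n k)"

definition first_descent_poly :: "real \<Rightarrow> real \<Rightarrow> nat \<Rightarrow> real" where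
  "first_descent_poly x y n = (\<Sum>k=1..n. first_value_poly x n k * y ^ k)"

lemma first_value_poly_Suc_first: "first_value_poly x (n + 1) 1 = descent_poly x n"
proof (cases "n = 0")
  case False
  have "first_value_poly x (n + 1) 1 = (\<Sum>j=1..n. (if j < 1 then x else 1) * first_value_poly x n j)"
    using False by (intro first_value_poly_Suc) auto
  also have "\<dots> = (\<Sum>j=1..n. first_value_poly x n j)"
    by (intro sum.cong) auto
  finally show ?thesis using False by (simp add: descent_poly_def)
qed (use first_value_poly_1 in \<open>simp add: descent_poly_def\<close>)

text \<open>A largest first value always descends if anything follows it. At \<open>n = 0\<close>
  nothing follows and the left side is 1 instead of \<open>x\<close>, which is the origin of the
  corrections \<open>x - 1\<close> in the recurrences below.\<close>

lemma first_value_poly_Suc_last: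
  assumes "1 \<le> n"
  shows "first_value_poly x (n + 1) (n + 1) = x * descent_poly x n"
proof -
  have "first_value_poly x (n + 1) (n + 1) =
      (\<Sum>j=1..n. (if j < n + 1 then x else 1) * first_value_poly x n j)"
    using assms by (intro first_value_poly_Suc) auto
  also have "\<dots> = (\<Sum>j=1..n. x * first_value_poly x n j)"
    by (intro sum.cong) auto
  finally show ?thesis using assms by (simp add: descent_poly_def sum_distrib_left)
qed

text \<open>Raising \<open>k\<close> by one changes only the weight of \<open>j = k\<close>, from 1
  to \<open>x\<close>.\<close>

lemma first_value_poly_Suc_diff:
  assumes "1 \<le> k" "k \<le> n"
  shows "first_value_poly x (n + 1) (k + 1) - first_value_poly x (n + 1) k =
    (x - 1) * first_value_poly x n k"
proof -
  have "first_value_poly x (n + 1) (k + 1) - first_value_poly x (n + 1) k =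
    (\<Sum>j=1..n. (if j < k + 1 then x else 1) * first_value_poly x n j) -
    (\<Sum>j=1..n. (if j < k then x else 1) * first_value_poly x n j)"
    using assms first_value_poly_Suc[of n k x] first_value_poly_Suc[of n "k + 1" x] by simp
  also have "\<dots> = (\<Sum>j=1..n. if j = k then (x - 1) * first_value_poly x n j else 0)"
    unfolding sum_subtractf[symmetric] by (intro sum.cong) (auto simp: algebra_simps)
  also have "\<dots> = (x - 1) * first_value_poly x n k"
    using assms by simp
  finally show ?thesis .
qed

text \<open>The difference equation, started at first value 1, is a Pascal recursion in
  \<open>k\<close>, so its iterates have binomial coefficients.\<close>

lemma first_value_poly_eq_binomial_sum:
  "k \<le> n \<Longrightarrow> first_value_poly x (n + 1) (k + 1) =
     (\<Sum>i\<le>k. real (k choose i) * (x - 1) ^ i * descent_poly x (n - i))"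
proof (induction k arbitrary: n)
  case 0
  then show ?case using first_value_poly_Suc_first[of x n] by simp
next
  case (Suc k)
  obtain m where n: "n = m + 1" using Suc.prems by (cases n) auto
  let ?t = "x - 1" and ?B = "descent_poly x"
  have "first_value_poly x (n + 1) (Suc k + 1) =
      first_value_poly x (n + 1) (k + 1) + ?t * first_value_poly x (m + 1) (k + 1)"
    using first_value_poly_Suc_diff[of "k + 1" n x] Suc.prems n by (simp add: algebra_simps)
  also have "\<dots> = (\<Sum>i\<le>k. real (k choose i) * ?t ^ i * ?B (n - i)) +
      ?t * (\<Sum>i\<le>k. real (k choose i) * ?t ^ i * ?B (m - i))"
    using Suc.IH[of n] Suc.IH[of m] Suc.prems n by simp
  \<comment> \<open>The added term has coefficient \<open>k choose Suc k = 0\<close>; with it, both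
    sums can be aligned by splitting off \<open>i = 0\<close>.\<close>
  also have "(\<Sum>i\<le>k. real (k choose i) * ?t ^ i * ?B (n - i)) =
      (\<Sum>i\<le>Suc k. real (k choose i) * ?t ^ i * ?B (n - i))"
    by simp
  also have "\<dots> = ?B n + (\<Sum>i\<le>k. real (k choose Suc i) * ?t ^ Suc i * ?B (m - i))"
    by (subst sum.atMost_Suc_shift) (simp add: n)
  also have "\<dots> + ?t * (\<Sum>i\<le>k. real (k choose i) * ?t ^ i * ?B (m - i)) =
      ?B n + (\<Sum>i\<le>k. real (Suc k choose Suc i) * ?t ^ Suc i * ?B (m - i))"
    by (simp add: sum_distrib_left sum.distrib[symmetric] algebra_simps)
  also have "\<dots> = (\<Sum>i\<le>Suc k. real (Suc k choose i) * ?t ^ i * ?B (n - i))"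
    by (subst sum.atMost_Suc_shift) (simp add: n)
  finally show ?case .
qed

text \<open>Both sides evaluate \<open>first_value_poly x (n + 1) (n + 1)\<close>: the left by
  climbing from first value 1, the right by the boundary value at the top.\<close>

lemma descent_poly_recurrence:
  "(\<Sum>i\<le>n. real (n choose i) * (x - 1) ^ i * descent_poly x (n - i)) =
     x * descent_poly x n - (if n = 0 then x - 1 else 0)"
  using first_value_poly_Suc_last[of n x] first_value_poly_eq_binomial_sum[of n n x]
  by (cases "n = 0") (auto simp: descent_poly_def)

lemma sum_by_parts_power:
  fixes y :: real
  shows "(1 - y) * (\<Sum>k=1..n + 1. p k * y ^ k) =
    p 1 * y - p (n + 1) * y ^ (n + 2) + (\<Sum>k=1..n. (p (k + 1) - p k) * y ^ (k + 1))"
proof (induction n)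
  case (Suc n)
  have "(1 - y) * (\<Sum>k=1..Suc n + 1. p k * y ^ k) =
      (1 - y) * (\<Sum>k=1..n + 1. p k * y ^ k) + (1 - y) * (p (n + 2) * y ^ (n + 2))"
    by (simp add: distrib_left)
  then show ?case
    unfolding Suc.IH by (simp add: left_diff_distrib)
qed (simp add: algebra_simps power2_eq_square)

text \<open>Abel summation replaces the coefficients by their differences, which are known multiples
  of those for \<open>n\<close>, and leaves the two boundary values.\<close>

lemma first_descent_poly_recurrence:
  "(1 - y) * first_descent_poly x y (n + 1) =
     (x - 1) * y * first_descent_poly x y n + y * descent_poly x n
     - x * y ^ (n + 2) * descent_poly x n + (if n = 0 then (x - 1) * y\<^sup>2 else 0)"
proof (cases "n = 0")
  case True
  then show ?thesis
    using first_value_poly_1[of x]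
    by (simp add: first_descent_poly_def descent_poly_def algebra_simps power2_eq_square)
next
  case False
  have "(\<Sum>k=1..n. (first_value_poly x (n + 1) (k + 1) - first_value_poly x (n + 1) k) * y ^ (k + 1))
      = (\<Sum>k=1..n. (x - 1) * y * (first_value_poly x n k * y ^ k))"
    by (intro sum.cong refl, subst first_value_poly_Suc_diff) auto
  then show ?thesis
    unfolding first_descent_poly_def sum_by_parts_power
    using False first_value_poly_Suc_first[of x n] first_value_poly_Suc_last[of n x]
    by (simp add: sum_distrib_left algebra_simps)
qed

section \<open>Signs and bounds of the descent polynomials\<close>

lemma first_value_poly_nonneg: "0 \<le> x \<Longrightarrow> 0 \<le> first_value_poly x n k"
  by (auto simp: first_value_poly_def intro!: sum_nonneg)

lemma abs_first_value_poly_le: "\<bar>first_value_poly x n k\<bar> \<le> first_value_poly \<bar>x\<bar> n k"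
  unfolding first_value_poly_def by (rule sum_abs[THEN order_trans]) (simp add: power_abs)

lemma descent_poly_nonneg: "0 \<le> x \<Longrightarrow> 0 \<le> descent_poly x n"
  by (auto simp: descent_poly_def intro!: sum_nonneg first_value_poly_nonneg)

lemma abs_descent_poly_le: "\<bar>descent_poly x n\<bar> \<le> descent_poly \<bar>x\<bar> n"
  by (auto simp: descent_poly_def intro!: sum_abs[THEN order_trans] sum_mono abs_first_value_poly_le)

lemma abs_first_descent_poly_le: "\<bar>first_descent_poly x y n\<bar> \<le> first_descent_poly \<bar>x\<bar> \<bar>y\<bar> n"
  unfolding first_descent_poly_def
  by (rule sum_abs[THEN order_trans])
     (auto simp: abs_mult power_abs intro!: sum_mono mult_right_mono abs_first_value_poly_le)

text \<open>With \<open>k = 1\<close> and \<open>k = n\<close>, where the boundary values apply,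
  this bounds \<open>descent_poly\<close> by \<open>first_descent_poly\<close>.\<close>

lemma first_descent_poly_ge:
  assumes "0 \<le> x" "0 \<le> y" "1 \<le> k" "k \<le> n"
  shows "first_value_poly x n k * y ^ k \<le> first_descent_poly x y n"
  unfolding first_descent_poly_def
  by (rule member_le_sum) (use assms in \<open>auto intro!: mult_nonneg_nonneg first_value_poly_nonneg\<close>)

text \<open>At \<open>x = 0\<close> only the permutation without descents, the identity, has nonzero
  weight.\<close>

lemma descent_poly_0: "descent_poly 0 n = 1"
proof (cases n)
  case (Suc m)
  have "first_value_poly 0 (m + 1) k = (if k = 1 then 1 else 0)" if "1 \<le> k" "k \<le> m + 1" for k
    using that
  proof (induction m arbitrary: k)
    case 0
    then have "k = 1" by auto
    then show ?case using first_value_poly_1 by simp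
  next
    case (Suc m)
    have "first_value_poly 0 (Suc m + 1) k =
        (\<Sum>j=1..Suc m. (if j < k then 0 else 1) * first_value_poly 0 (Suc m) j)"
      using first_value_poly_Suc[of "Suc m" k 0] Suc.prems by simp
    also have "\<dots> = (\<Sum>j=1..Suc m. if j = 1 then if j < k then 0 else 1 else 0)"
      by (intro sum.cong refl) (use Suc.IH in auto)
    also have "\<dots> = (if k = 1 then 1 else 0)"
      using Suc.prems by simp
    finally show ?case .
  qed
  then have "(\<Sum>k=1..m + 1. first_value_poly 0 (m + 1) k) = (\<Sum>k=1..m + 1. if k = 1 then 1 else 0)"
    by (intro sum.cong) auto
  then show ?thesis using Suc by (simp add: descent_poly_def)
qed (simp add: descent_poly_def)

section \<open>Exponential generating functions\<close>

text \<open>The binomial recurrence is a Cauchy product with the series of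
  \<open>exp ((x - 1) * s)\<close>. The hypothesis at \<open>\<bar>x\<bar>\<close> and
  \<open>\<bar>s\<bar>\<close> supplies the absolute convergence that the product needs.\<close>

lemma descent_egf_sums:
  assumes "summable (\<lambda>n. descent_poly \<bar>x\<bar> n / fact n * \<bar>s\<bar> ^ n)"
  shows "summable (\<lambda>n. descent_poly x n / fact n * s ^ n)"
    and "(\<Sum>n. descent_poly x n / fact n * s ^ n) * (x - exp ((x - 1) * s)) = x - 1"
proof -
  define b where "b n = descent_poly x n / fact n * s ^ n" for n
  define e where "e n = ((x - 1) * s) ^ n /\<^sub>R fact n" for n
  have b: "summable (\<lambda>n. norm (b n))"
    by (rule summable_comparison_test'[OF assms, of 0])
       (auto simp: b_def abs_mult power_abs intro!: mult_right_mono divide_right_mono abs_descent_poly_le)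
  have e: "summable (\<lambda>n. norm (e n))"
    unfolding e_def by (rule summable_norm_exp)
  show summ: "summable (\<lambda>n. descent_poly x n / fact n * s ^ n)"
    using summable_norm_cancel[OF b] by (simp add: b_def)
  have conv: "(\<Sum>i\<le>n. e i * b (n - i)) = x * b n - (if n = 0 then x - 1 else 0)" for n
  proof -
    have "e i * b (n - i) =
        s ^ n / fact n * (real (n choose i) * (x - 1) ^ i * descent_poly x (n - i))"
      if "i \<le> n" for i
    proof -
      have "s ^ n = s ^ i * s ^ (n - i)" using that by (simp flip: power_add)
      then show ?thesis
        using that
        unfolding e_def b_def power_mult_distrib by (simp add: binomial_fact field_simps)
    qed
    then have "(\<Sum>i\<le>n. e i * b (n - i)) =
        s ^ n / fact n * (\<Sum>i\<le>n. real (n choose i) * (x - 1) ^ i * descent_poly x (n - i))"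
      by (simp add: sum_distrib_left)
    also have "\<dots> = x * b n - (if n = 0 then x - 1 else 0)"
      unfolding descent_poly_recurrence by (simp add: b_def)
    finally show ?thesis .
  qed
  have "(\<lambda>n. x * b n - (if n = 0 then x - 1 else 0)) sums (x * (\<Sum>n. b n) - (x - 1))"
    using summable_norm_cancel[OF b]
    by (intro sums_diff sums_mult summable_sums sums_single[of 0 "\<lambda>_. x - 1", simplified])
  moreover have "(\<lambda>n. x * b n - (if n = 0 then x - 1 else 0)) sums ((\<Sum>n. e n) * (\<Sum>n. b n))"
    using Cauchy_product_sums[OF e b] by (simp add: conv)
  ultimately have "x * (\<Sum>n. b n) - (x - 1) = (\<Sum>n. e n) * (\<Sum>n. b n)"
    by (rule sums_unique2)
  moreover have "(\<Sum>n. e n) = exp ((x - 1) * s)"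
    by (simp add: e_def exp_def)
  ultimately show "(\<Sum>n. descent_poly x n / fact n * s ^ n) * (x - exp ((x - 1) * s)) = x - 1"
    by (simp add: b_def algebra_simps)
qed

section \<open>Radius of convergence of the descent series\<close>

lemma summable_descent_egf:
  assumes c: "summable (\<lambda>n. descent_poly x n / fact (n + 1) * K ^ (n + 1))" and s: "\<bar>s\<bar> < \<bar>K\<bar>"
  shows "summable (\<lambda>n. descent_poly x n / fact n * s ^ n)"
proof -
  \<comment> \<open>These are the coefficients of an antiderivative of the wanted series; termwise
    differentiation keeps convergence strictly inside \<open>\<bar>K\<bar>\<close>.\<close>
  define c where "c n = (if n = 0 then 0 else descent_poly x (n - 1) / fact n)" for n
  have "summable (\<lambda>n. c (Suc n) * K ^ Suc n)"
    using assms(1) by (simp add: c_def)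
  then have "summable (\<lambda>n. c n * K ^ n)"
    by (subst (asm) summable_Suc_iff)
  then have "summable (\<lambda>n. diffs c n * s ^ n)"
    using s by (intro termdiff_converges[of _ "\<bar>K\<bar>"]) (auto intro: powser_inside)
  moreover have "diffs c n = descent_poly x n / fact n" for n
    by (simp add: diffs_def c_def fact_Suc del: of_nat_Suc)
  ultimately show ?thesis by simp
qed

text \<open>First value 1 contributes \<open>y * descent_poly x n\<close> to
  \<open>first_descent_poly x y (n + 1)\<close>, which gives radius \<open>z\<close>. First value
  \<open>n + 1\<close> contributes \<open>x * descent_poly x n * y ^ (n + 1)\<close>, which gives
  radius \<open>y * z\<close> once \<open>x\<close> is nonzero.\<close>

lemma summable_descent_egf_of_first_descent:
  assumes A: "summable (\<lambda>n. first_descent_poly x y n / fact n * z ^ n)"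
    and nonneg: "0 \<le> x" "0 < y" "0 \<le> z" and s: "\<bar>s\<bar> < z \<or> \<bar>s\<bar> < y * z"
  shows "summable (\<lambda>n. descent_poly x n / fact n * s ^ n)"
proof (cases "x = 0")
  case True
  show ?thesis
    using summable_exp_generic[of s] by (simp add: True descent_poly_0 field_simps)
next
  case False
  have A1: "summable (\<lambda>n. first_descent_poly x y (n + 1) / fact (n + 1) * z ^ (n + 1))"
    using A by (subst (asm) summable_Suc_iff[symmetric]) simp
  from s show ?thesis
  proof
    assume s: "\<bar>s\<bar> < z"
    have "summable (\<lambda>n. y * (descent_poly x n / fact (n + 1) * z ^ (n + 1)))"
    proof (rule summable_comparison_test'[OF A1, of 0])
      fix n
      have "y * descent_poly x n \<le> first_descent_poly x y (n + 1)"
        using first_descent_poly_ge[of x y 1 "n + 1"] nonneg first_value_poly_Suc_first[of x n]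
        by (simp add: mult.commute)
      then have "y * descent_poly x n / fact (n + 1) * z ^ (n + 1) \<le>
          first_descent_poly x y (n + 1) / fact (n + 1) * z ^ (n + 1)"
        using nonneg by (intro mult_right_mono divide_right_mono) auto
      moreover have "0 \<le> y * (descent_poly x n / fact (n + 1) * z ^ (n + 1))"
        using nonneg descent_poly_nonneg[of x n] by (intro mult_nonneg_nonneg divide_nonneg_nonneg) auto
      ultimately show "norm (y * (descent_poly x n / fact (n + 1) * z ^ (n + 1))) \<le>
          first_descent_poly x y (n + 1) / fact (n + 1) * z ^ (n + 1)"
        by simp
    qed
    then have "summable (\<lambda>n. descent_poly x n / fact (n + 1) * z ^ (n + 1))"
      using nonneg by (subst (asm) summable_cmult_iff) auto
    then show ?thesis using s nonneg by (intro summable_descent_egf[of x z]) auto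
  next
    assume s: "\<bar>s\<bar> < y * z"
    have "summable (\<lambda>n. x * (descent_poly x n / fact (n + 1) * (y * z) ^ (n + 1)))"
    \<comment> \<open>The comparison starts at 1 because the boundary value for first value
      \<open>n + 1\<close> fails at \<open>n = 0\<close>.\<close>
    proof (rule summable_comparison_test'[OF A1, of 1])
      fix n :: nat assume n: "1 \<le> n"
      have "x * descent_poly x n * y ^ (n + 1) \<le> first_descent_poly x y (n + 1)"
        using first_descent_poly_ge[of x y "n + 1" "n + 1"] nonneg first_value_poly_Suc_last[of n x] n
        by simp
      then have "x * descent_poly x n * y ^ (n + 1) / fact (n + 1) * z ^ (n + 1) \<le>
          first_descent_poly x y (n + 1) / fact (n + 1) * z ^ (n + 1)"
        using nonneg by (intro mult_right_mono divide_right_mono) auto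
      moreover have "0 \<le> x * (descent_poly x n / fact (n + 1) * (y * z) ^ (n + 1))"
        using nonneg descent_poly_nonneg[of x n] by (intro mult_nonneg_nonneg divide_nonneg_nonneg) auto
      ultimately show "norm (x * (descent_poly x n / fact (n + 1) * (y * z) ^ (n + 1))) \<le>
          first_descent_poly x y (n + 1) / fact (n + 1) * z ^ (n + 1)"
        by (simp add: power_mult_distrib mult_ac)
    qed
    then have "summable (\<lambda>n. descent_poly x n / fact (n + 1) * (y * z) ^ (n + 1))"
      using False by (subst (asm) summable_cmult_iff) auto
    then show ?thesis using s nonneg by (intro summable_descent_egf[of x "y * z"]) auto
  qed
qed

section \<open>From the triple sum to a power series in z\<close>

lemma first_descent_poly_eq_sum_permutations:
  assumes "1 \<le> n"
  shows "first_descent_poly x y n =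
    (\<Sum>\<pi> | \<pi> permutes {1..int n}. x ^ Des (int n) \<pi> * y ^ nat (\<pi> 1))"
proof -
  let ?S = "{\<pi>. \<pi> permutes {1..int n}}"
  have "(\<Sum>\<pi>\<in>?S. x ^ Des (int n) \<pi> * y ^ nat (\<pi> 1)) =
      (\<Sum>k=1..n. \<Sum>\<pi> | \<pi> \<in> ?S \<and> nat (\<pi> 1) = k. x ^ Des (int n) \<pi> * y ^ nat (\<pi> 1))"
  proof (intro sum.group[symmetric] image_subsetI)
    fix \<sigma> assume "\<sigma> \<in> ?S"
    then show "nat (\<sigma> 1) \<in> {1..n}"
      using permutes_interval_range[of \<sigma> 1 "int n" 1] assms by auto
  qed (auto simp: finite_permutations)
  also have "\<dots> = first_descent_poly x y n"
    unfolding first_descent_poly_def first_value_poly_def sum_distrib_right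
    by (intro sum.cong) auto
  finally show ?thesis by simp
qed

lemma has_sum_eulerian_first_term_fixed_n:
  assumes "1 \<le> n"
  shows "((\<lambda>p. eulerian_first_term x y z (int n, p)) has_sum
    first_descent_poly x y n / fact n * z ^ n) UNIV"
proof -
  let ?S = "{\<pi>. \<pi> permutes {1..int n}}"
  let ?h = "\<lambda>\<pi>. (int (Des (int n) \<pi>), \<pi> 1)"
  have fin: "finite ?S" by (auto simp: finite_permutations)
  have count: "eulerian_first (int n) (fst p) (snd p) = card {\<pi> \<in> ?S. ?h \<pi> = p}" for p
    unfolding eulerian_first_def using assms
    by (intro arg_cong[of _ _ card]) (auto simp: prod_eq_iff)
  have val: "eulerian_first_term x y z (int n, p) =
      (\<Sum>\<pi> | \<pi> \<in> ?S \<and> ?h \<pi> = p. x ^ Des (int n) \<pi> * y ^ nat (\<pi> 1)) * (z ^ n / fact n)" for p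
  proof -
    have "x ^ Des (int n) \<pi> * y ^ nat (\<pi> 1) = x powi fst p * y powi snd p"
      if "\<pi> \<in> ?S" "?h \<pi> = p" for \<pi>
    proof -
      have "0 \<le> \<pi> 1" using permutes_interval_range[of \<pi> 1 "int n" 1] that assms by auto
      then show ?thesis using that by (auto simp: power_int_def)
    qed
    then have "(\<Sum>\<pi> | \<pi> \<in> ?S \<and> ?h \<pi> = p. x ^ Des (int n) \<pi> * y ^ nat (\<pi> 1)) =
        (\<Sum>\<pi> | \<pi> \<in> ?S \<and> ?h \<pi> = p. x powi fst p * y powi snd p)"
      by (intro sum.cong) auto
    then show ?thesis
      using count[of p] by (simp add: eulerian_first_term_def case_prod_beta)
  qed
  show ?thesis
  \<comment> \<open>Only the finitely many pairs attained by some permutation contribute; the fibres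
    of \<open>?h\<close> over them partition the permutations.\<close>
  proof (rule has_sum_finite_neutralI[where B = "?h ` ?S"])
    fix p assume "p \<in> UNIV - ?h ` ?S"
    then have empty: "{\<pi>. \<pi> \<in> ?S \<and> ?h \<pi> = p} = {}" by auto
    show "eulerian_first_term x y z (int n, p) = 0"
      unfolding val empty by simp
  next
    have "first_descent_poly x y n / fact n * z ^ n =
        (\<Sum>\<pi>\<in>?S. x ^ Des (int n) \<pi> * y ^ nat (\<pi> 1)) * (z ^ n / fact n)"
      using first_descent_poly_eq_sum_permutations[OF assms] by simp
    also have "(\<Sum>\<pi>\<in>?S. x ^ Des (int n) \<pi> * y ^ nat (\<pi> 1)) =
        (\<Sum>p\<in>?h ` ?S. \<Sum>\<pi> | \<pi> \<in> ?S \<and> ?h \<pi> = p. x ^ Des (int n) \<pi> * y ^ nat (\<pi> 1))"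
      by (rule sum.image_gen[OF fin])
    finally show "first_descent_poly x y n / fact n * z ^ n =
        (\<Sum>p\<in>?h ` ?S. eulerian_first_term x y z (int n, p))"
      unfolding val sum_distrib_right .
  qed (use fin in auto)
qed

lemma eulerian_first_term_sums:
  assumes "eulerian_first_term x y z summable_on UNIV"
  shows "(\<lambda>n. first_descent_poly x y n / fact n * z ^ n) sums
    infsum (eulerian_first_term x y z) UNIV"
proof -
  define g where "g n = first_descent_poly x y n / fact n * z ^ n" for n
  have g0: "g 0 = 0" by (simp add: g_def first_descent_poly_def)
  have "(eulerian_first_term x y z has_sum infsum (eulerian_first_term x y z) UNIV) (UNIV \<times> UNIV)"
    using assms by simp
  then have "((\<lambda>n. if n > 0 then g (nat n) else 0) has_sum
      infsum (eulerian_first_term x y z) UNIV) (UNIV :: int set)"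
  \<comment> \<open>The sum over \<open>(d, k)\<close> is carried out first for each integer
    \<open>n\<close>; nonpositive \<open>n\<close> contribute 0.\<close>
  proof (rule has_sum_SigmaD)
    fix n :: int
    show "((\<lambda>p. eulerian_first_term x y z (n, p)) has_sum (if n > 0 then g (nat n) else 0)) UNIV"
    proof (cases "n > 0")
      case True
      then show ?thesis
        using has_sum_eulerian_first_term_fixed_n[of "nat n" x y z] by (simp add: g_def)
    next
      case False
      then have "eulerian_first_term x y z (n, p) = 0" for p
        by (simp add: eulerian_first_term_def eulerian_first_def case_prod_beta)
      then show ?thesis using False by simp
    qed
  qed
  also have "?this \<longleftrightarrow> ((\<lambda>n. if n > 0 then g (nat n) else 0) has_sum
      infsum (eulerian_first_term x y z) UNIV) (range int)"
  proof (rule has_sum_cong_neutral)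
    fix n :: int assume "n \<in> UNIV - range int"
    then have "\<not> n > 0" using zero_le_imp_eq_int[of n] by auto
    then show "(if n > 0 then g (nat n) else 0) = 0" by simp
  qed auto
  also have "\<dots> \<longleftrightarrow> ((\<lambda>n. if n > 0 then g (nat n) else 0) \<circ> int has_sum
      infsum (eulerian_first_term x y z) UNIV) UNIV"
    by (rule has_sum_reindex) simp
  also have "(\<lambda>n. if n > 0 then g (nat n) else 0) \<circ> int = g"
    using g0 by (auto simp: fun_eq_iff)
  finally have "(g has_sum infsum (eulerian_first_term x y z) UNIV) UNIV" .
  from has_sum_imp_sums[OF this] show ?thesis
    unfolding g_def .
qed

text \<open>Summability over a set is absolute for real terms, and the absolute value of a term is
  the term at the absolute values. This gives access to the comparison bounds, which need
  nonnegative arguments.\<close>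

lemma eulerian_first_term_summable_abs:
  assumes "eulerian_first_term x y z summable_on UNIV"
  shows "eulerian_first_term \<bar>x\<bar> \<bar>y\<bar> \<bar>z\<bar> summable_on UNIV"
proof -
  have "norm (eulerian_first_term x y z p) = eulerian_first_term \<bar>x\<bar> \<bar>y\<bar> \<bar>z\<bar> p" for p
    by (simp add: eulerian_first_term_def case_prod_beta abs_mult power_int_abs)
  then show ?thesis
    using summable_on_iff_abs_summable_on_real[THEN iffD1, OF assms] by simp
qed

section \<open>The differential equation and its solution\<close>

lemma powser_continuous_on_cball:
  fixes c :: "nat \<Rightarrow> real"
  assumes "summable (\<lambda>n. \<bar>c n\<bar> * r ^ n)"
  shows "continuous_on {-r..r} (\<lambda>s. \<Sum>n. c n * s ^ n)"
proof (rule uniform_limit_theorem)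
  show "uniform_limit {-r..r} (\<lambda>n s. \<Sum>i<n. c i * s ^ i) (\<lambda>s. \<Sum>n. c n * s ^ n) sequentially"
  proof (rule Weierstrass_m_test[OF _ assms])
    fix n s assume "s \<in> {-r..r}"
    then have "\<bar>s\<bar> ^ n \<le> r ^ n" by (intro power_mono) auto
    then show "norm (c n * s ^ n) \<le> \<bar>c n\<bar> * r ^ n"
      by (auto simp: abs_mult power_abs intro!: mult_left_mono)
  qed
qed (auto intro!: always_eventually continuous_intros)

text \<open>This is the recurrence of \<open>first_descent_poly\<close> summed termwise; the
  argument \<open>y * s\<close> arises from
  \<open>y ^ (n + 2) * s ^ n = y\<^sup>2 * (y * s) ^ n\<close>.\<close>

lemma first_descent_egf_ODE:
  fixes x y s :: real
  defines "F \<equiv> \<lambda>s. \<Sum>n. first_descent_poly x y n / fact n * s ^ n"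
    and "B \<equiv> \<lambda>s. \<Sum>n. descent_poly x n / fact n * s ^ n"
  assumes F: "summable (\<lambda>n. first_descent_poly x y n / fact n * z ^ n)" and s: "\<bar>s\<bar> < \<bar>z\<bar>"
    and B: "summable (\<lambda>n. descent_poly x n / fact n * s ^ n)"
    and By: "summable (\<lambda>n. descent_poly x n / fact n * (y * s) ^ n)"
  obtains D where "(F has_real_derivative D) (at s)"
    and "(1 - y) * D = (x - 1) * y * F s + y * B s - x * y\<^sup>2 * B (y * s) + (x - 1) * y\<^sup>2"
proof
  define c where "c n = first_descent_poly x y n / fact n" for n
  have F_eq: "F = (\<lambda>s. \<Sum>n. c n * s ^ n)" by (simp add: F_def c_def)
  have Fc: "summable (\<lambda>n. c n * z ^ n)"
    using F unfolding c_def .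
  have inside: "summable (\<lambda>n. c n * t ^ n)" if "norm t < \<bar>z\<bar>" for t
    by (rule powser_inside[OF Fc]) (use that in simp)
  show "(F has_real_derivative (\<Sum>n. diffs c n * s ^ n)) (at s)"
    unfolding F_eq by (rule termdiffs_strong[OF Fc]) (use s in simp)
  have "summable (\<lambda>n. c n * s ^ n)"
    by (rule inside) (use s in simp)
  moreover have "summable (\<lambda>n. diffs c n * s ^ n)"
    by (rule termdiff_converges[OF _ inside, of s "\<bar>z\<bar>"]) (use s in simp_all)
  ultimately have sums: "(\<lambda>n. c n * s ^ n) sums F s"
      "(\<lambda>n. diffs c n * s ^ n) sums (\<Sum>n. diffs c n * s ^ n)"
    unfolding F_eq by (auto intro: summable_sums)
  have "(\<lambda>n. (x - 1) * y * (c n * s ^ n) + y * (descent_poly x n / fact n * s ^ n)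
        - x * y\<^sup>2 * (descent_poly x n / fact n * (y * s) ^ n)
        + (if n = 0 then (x - 1) * y\<^sup>2 else 0))
      sums ((x - 1) * y * F s + y * B s - x * y\<^sup>2 * B (y * s) + (x - 1) * y\<^sup>2)"
    unfolding B_def
    by (intro sums_add sums_diff sums_mult sums summable_sums B By
        sums_single[of 0 "\<lambda>_. (x - 1) * y\<^sup>2", simplified])
  moreover have "(x - 1) * y * (c n * s ^ n) + y * (descent_poly x n / fact n * s ^ n)
        - x * y\<^sup>2 * (descent_poly x n / fact n * (y * s) ^ n)
        + (if n = 0 then (x - 1) * y\<^sup>2 else 0) = (1 - y) * (diffs c n * s ^ n)" for n
  proof -
    have d: "diffs c n = first_descent_poly x y (n + 1) / fact n"
      by (simp add: diffs_def c_def fact_Suc del: of_nat_Suc)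
    have "(1 - y) * (diffs c n * s ^ n) = (1 - y) * first_descent_poly x y (n + 1) * (s ^ n / fact n)"
      by (simp add: d)
    also have "\<dots> = (x - 1) * y * (c n * s ^ n) + y * (descent_poly x n / fact n * s ^ n)
        - x * y\<^sup>2 * (descent_poly x n / fact n * (y * s) ^ n)
        + (if n = 0 then (x - 1) * y\<^sup>2 else 0) * (s ^ n / fact n)"
      unfolding first_descent_poly_recurrence
      by (simp add: c_def power_mult_distrib algebra_simps diff_divide_distrib add_divide_distrib
          power2_eq_square)
    finally show ?thesis by (cases "n = 0") auto
  qed
  ultimately have "(\<lambda>n. (1 - y) * (diffs c n * s ^ n))
      sums ((x - 1) * y * F s + y * B s - x * y\<^sup>2 * B (y * s) + (x - 1) * y\<^sup>2)"
    by simp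
  moreover have "(\<lambda>n. (1 - y) * (diffs c n * s ^ n)) sums ((1 - y) * (\<Sum>n. diffs c n * s ^ n))"
    by (intro sums_mult sums)
  ultimately show "(1 - y) * (\<Sum>n. diffs c n * s ^ n) =
      (x - 1) * y * F s + y * B s - x * y\<^sup>2 * B (y * s) + (x - 1) * y\<^sup>2"
    by (rule sums_unique2[symmetric])
qed

text \<open>The difference of the two sides, taken along the segment from 0 to \<open>z\<close>, is
  0 at the start and has derivative 0 inside. The interval must contain 0, since both
  \<open>s\<close> and \<open>y * s\<close> start there.\<close>

lemma first_descent_egf_integrated:
  fixes x y z a :: real and Q :: "real \<Rightarrow> real"
  defines "F \<equiv> \<lambda>s. \<Sum>n. first_descent_poly x y n / fact n * s ^ n"
  assumes y: "y \<noteq> 0" "y \<noteq> 1" and x: "x \<noteq> 1" and a: "a * (1 - y) = (1 - x) * y"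
    and summ: "summable (\<lambda>n. first_descent_poly \<bar>x\<bar> \<bar>y\<bar> n / fact n * \<bar>z\<bar> ^ n)"
    and Q: "\<And>w. w \<in> {lo..hi} \<Longrightarrow>
      (Q has_real_derivative a * exp (a * w) / (x - exp ((x - 1) * w))) (at w within {lo..hi})"
    and lo: "lo \<le> 0" "lo \<le> z" "lo \<le> y * z" and hi: "0 \<le> hi" "z \<le> hi" "y * z \<le> hi"
  shows "exp (a * z) * F z = Q (y * z) - Q z"
proof (cases "z = 0")
  case True
  have "F 0 = 0"
    using powser_zero[of "\<lambda>n. first_descent_poly x y n / fact n"]
    by (simp add: F_def first_descent_poly_def)
  then show ?thesis using True by simp
next
  case False
  define B where "B s = (\<Sum>n. descent_poly x n / fact n * s ^ n)" for s
  \<comment> \<open>The parameter in \<open>{0..1}\<close> treats both signs of \<open>z\<close> and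
    \<open>y\<close> at once.\<close>
  define \<phi> where "\<phi> \<tau> = exp (a * (z * \<tau>)) * F (z * \<tau>) - Q (y * z * \<tau>) + Q (z * \<tau>)" for \<tau>
  have abs_summ: "summable (\<lambda>n. \<bar>first_descent_poly x y n / fact n\<bar> * \<bar>z\<bar> ^ n)"
    by (rule summable_comparison_test'[OF summ, of 0])
       (auto simp: intro!: mult_right_mono divide_right_mono abs_first_descent_poly_le)
  then have Fz: "summable (\<lambda>n. first_descent_poly x y n / fact n * z ^ n)"
    by (intro summable_norm_cancel[of "\<lambda>n. first_descent_poly x y n / fact n * z ^ n"])
       (simp add: abs_mult power_abs)
  have Fcont: "continuous_on {-\<bar>z\<bar>..\<bar>z\<bar>} F"
    unfolding F_def using abs_summ by (rule powser_continuous_on_cball)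
  have range: "z * \<tau> \<in> {lo..hi}" "y * z * \<tau> \<in> {lo..hi}" "z * \<tau> \<in> {-\<bar>z\<bar>..\<bar>z\<bar>}"
    if "\<tau> \<in> {0..1}" for \<tau>
  proof -
    have seg: "u * \<tau> \<in> {l..h}" if "l \<le> 0" "l \<le> u" "0 \<le> h" "u \<le> h" for u l h :: real
    proof (cases "0 \<le> u")
      case True
      then have "0 \<le> u * \<tau>" "u * \<tau> \<le> u"
        using \<open>\<tau> \<in> {0..1}\<close> by (auto simp: mult_left_le)
      then show ?thesis using that by auto
    next
      case False
      then have "u * \<tau> \<le> 0" "u \<le> u * \<tau>"
        using \<open>\<tau> \<in> {0..1}\<close> mult_left_le[of \<tau> "- u"] by (auto simp: mult_le_0_iff)
      then show ?thesis using that by auto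
    qed
    show "z * \<tau> \<in> {lo..hi}" "y * z * \<tau> \<in> {lo..hi}" "z * \<tau> \<in> {-\<bar>z\<bar>..\<bar>z\<bar>}"
      using lo hi by (intro seg; simp)+
  qed
  have Qcont: "continuous_on {lo..hi} Q"
    using Q by (intro DERIV_continuous_on) auto
  have "continuous_on {0..1} \<phi>"
    unfolding \<phi>_def
    by (intro continuous_intros continuous_on_compose2[OF Fcont] continuous_on_compose2[OF Qcont])
       (use range in auto)
  moreover have "(\<phi> has_real_derivative 0) (at \<tau>)" if \<tau>: "0 < \<tau>" "\<tau> < 1" for \<tau>
  proof -
    define s where "s = z * \<tau>"
    have s: "\<bar>s\<bar> < \<bar>z\<bar>" "\<bar>y * s\<bar> < \<bar>y\<bar> * \<bar>z\<bar>"
      using False \<tau> y by (auto simp: s_def abs_mult)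
    have interior: "s \<in> interior {lo..hi}" "y * s \<in> interior {lo..hi}"
    \<comment> \<open>Interior points are needed to turn the derivative of \<open>Q\<close> within
      the interval into a two-sided one.\<close>
    proof -
      have seg: "u * \<tau> \<in> {lo<..<hi}" if "u \<noteq> 0" "lo \<le> u" "u \<le> hi" for u
      proof (cases "0 < u")
        case True
        then have "0 < u * \<tau>" "u * \<tau> < u" using \<tau> by auto
        then show ?thesis using that lo hi by auto
      next
        case False
        then have "u < 0" using that by auto
        then have "u * \<tau> < 0" "u < u * \<tau>" using \<tau> by (auto simp: mult_less_0_iff)
        then show ?thesis using that lo hi by auto
      qed
      show "s \<in> interior {lo..hi}" "y * s \<in> interior {lo..hi}"
        using seg[of z] seg[of "y * z"] False y lo hi
        by (auto simp: s_def interior_atLeastAtMost_real mult_ac)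
    qed
    have Qs: "(Q has_real_derivative a * exp (a * w) / (x - exp ((x - 1) * w))) (at w)"
      if "w \<in> interior {lo..hi}" for w
      using Q[of w] that interior_subset[of "{lo..hi}"] at_within_interior[OF that] by fastforce
    have Bs: "summable (\<lambda>n. descent_poly x n / fact n * w ^ n) \<and> B w * (x - exp ((x - 1) * w)) = x - 1"
      if "\<bar>w\<bar> < \<bar>z\<bar> \<or> \<bar>w\<bar> < \<bar>y\<bar> * \<bar>z\<bar>" for w
    proof -
      have "summable (\<lambda>n. descent_poly \<bar>x\<bar> n / fact n * \<bar>w\<bar> ^ n)"
        using that y by (intro summable_descent_egf_of_first_descent[OF summ]) auto
      from descent_egf_sums[OF this] show ?thesis by (simp add: B_def)
    qed
    obtain D where D: "(F has_real_derivative D) (at s)"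
      and ode: "(1 - y) * D = (x - 1) * y * F s + y * B s - x * y\<^sup>2 * B (y * s) + (x - 1) * y\<^sup>2"
      using first_descent_egf_ODE[OF Fz s(1)] Bs[of s] Bs[of "y * s"] s
      unfolding F_def B_def by blast
    define G where "G w = 1 / (x - exp ((x - 1) * w))" for w
    have nz: "x - exp ((x - 1) * s) \<noteq> 0" "x - exp ((x - 1) * (y * s)) \<noteq> 0"
      using Bs[of s] Bs[of "y * s"] s x by auto
    have BG: "B s = (x - 1) * G s" "B (y * s) = (x - 1) * G (y * s)"
      using Bs[of s] Bs[of "y * s"] s nz by (auto simp: G_def field_simps)
    \<comment> \<open>The summand 1 cancels the inhomogeneous term
      \<open>(x - 1) * y\<^sup>2\<close> of the differential equation.\<close>
    have "x * G (y * s) = 1 + exp ((x - 1) * (y * s)) * G (y * s)"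
      using nz(2) by (simp add: G_def field_simps)
    then have "(1 - y) * D =
        (1 - x) * y * (- F s - G s + y * (exp ((x - 1) * (y * s)) * G (y * s)))"
      unfolding ode BG by algebra
    then have "(1 - y) * D = (1 - y) * (a * (- F s - G s + y * (exp ((x - 1) * (y * s)) * G (y * s))))"
      using a by algebra
    then have D_eq: "D = a * (- F s - G s + y * (exp ((x - 1) * (y * s)) * G (y * s)))"
      using y by simp
    \<comment> \<open>This identity is why \<open>a\<close> is the right exponent: the integrating
      factor turns the exponential at \<open>y * s\<close> into the numerator of \<open>Q'\<close>
      there.\<close>
    have "a * s + (x - 1) * (y * s) = a * (y * s)"
      using a by algebra
    then have exp_eq: "exp (a * s) * exp ((x - 1) * (y * s)) = exp (a * (y * s))"
      by (simp flip: exp_add)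
    have "(\<phi> has_real_derivative
        z * (a * exp (a * s) * F s + exp (a * s) * D - y * (a * exp (a * (y * s)) * G (y * s))
          + a * exp (a * s) * G s)) (at \<tau>)"
    proof -
      have Qs': "(Q has_real_derivative a * exp (a * s) * G s) (at (z * \<tau>))"
          "(Q has_real_derivative a * exp (a * (y * s)) * G (y * s)) (at (y * z * \<tau>))"
        using Qs[OF interior(1)] Qs[OF interior(2)] by (simp_all add: G_def s_def mult.assoc)
      have 1: "((\<lambda>\<tau>. F (z * \<tau>)) has_real_derivative D * z) (at \<tau>)"
        using D unfolding s_def by (rule DERIV_chain2) (auto intro!: derivative_eq_intros)
      have 2: "((\<lambda>\<tau>. Q (z * \<tau>)) has_real_derivative a * exp (a * s) * G s * z) (at \<tau>)"
        using Qs'(1) by (rule DERIV_chain2) (auto intro!: derivative_eq_intros)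
      have 3: "((\<lambda>\<tau>. Q (y * z * \<tau>)) has_real_derivative
          a * exp (a * (y * s)) * G (y * s) * (y * z)) (at \<tau>)"
        using Qs'(2) by (rule DERIV_chain2) (auto intro!: derivative_eq_intros)
      show ?thesis
        unfolding \<phi>_def
        by (rule derivative_eq_intros 1 2 3 refl)+ (simp add: s_def algebra_simps)
    qed
    also have "z * (a * exp (a * s) * F s + exp (a * s) * D - y * (a * exp (a * (y * s)) * G (y * s))
          + a * exp (a * s) * G s) = 0"
      unfolding D_eq exp_eq[symmetric] by algebra
    finally show ?thesis .
  qed
  ultimately have "\<phi> 1 = \<phi> 0"
    by (intro DERIV_isconst_end) auto
  moreover have "F 0 = 0"
    using powser_zero[of "\<lambda>n. first_descent_poly x y n / fact n"]
    by (simp add: F_def first_descent_poly_def)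
  ultimately show ?thesis by (simp add: \<phi>_def)
qed

section \<open>The substitution t = exp (a w)\<close>

theorem theorem4:
  fixes x y z \<theta> :: real
  assumes "y \<noteq> 0" and "inverse y - 1 \<noteq> 0"
    and "\<theta> = exp ((1 - x) / (inverse y - 1) * z)"
    and "eulerian_first_term x y z summable_on UNIV"
    and "\<And>t. t \<in> closed_segment \<theta> (\<theta> powr y) \<Longrightarrow> x - t powr (1 - 1 / y) \<noteq> 0"
  shows "infsum (eulerian_first_term x y z) UNIV =
    1 / \<theta> * (LBINT t=ereal \<theta>..ereal (\<theta> powr y). 1 / (x - t powr (1 - 1 / y)))"
proof -
  define a where "a = (1 - x) / (inverse y - 1)"
  have y1: "y \<noteq> 1" using assms(2) by auto
  have a: "a * (1 - y) = (1 - x) * y"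
    using assms(1) y1 by (simp add: a_def field_simps)
  have \<theta>: "\<theta> = exp (a * z)" using assms(3) by (simp add: a_def)
  have \<theta>y: "\<theta> powr y = exp (a * (y * z))" by (simp add: \<theta> powr_def mult_ac)
  have a_exp: "a * w * (1 - 1 / y) = (x - 1) * w" for w
  proof -
    have "a * (1 - 1 / y) * y = a * (y - 1)"
      using assms(1) by (simp add: field_simps)
    also have "\<dots> = (x - 1) * y"
      using a by algebra
    finally have "a * (1 - 1 / y) * y = (x - 1) * y" .
    then have "a * (1 - 1 / y) = x - 1" using assms(1) by simp
    then show ?thesis by algebra
  qed
  have powr_eq: "exp (a * w) powr (1 - 1 / y) = exp ((x - 1) * w)" for w
    using a_exp[of w] by (simp add: powr_def mult_ac)
  \<comment> \<open>Convergence of the descent series is known only for smaller absolute values, so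
    at \<open>z\<close> and \<open>y * z\<close> the hypothesis on the integrand is used
    instead.\<close>
  have ends: "x - exp ((x - 1) * z) \<noteq> 0" "x - exp ((x - 1) * (y * z)) \<noteq> 0"
    using assms(5)[of \<theta>] assms(5)[of "\<theta> powr y"] powr_eq[of z] powr_eq[of "y * z"]
    unfolding \<theta>y unfolding \<theta> by auto
  \<comment> \<open>At \<open>x = 1\<close> the denominator would be identically 0.\<close>
  then have x1: "x \<noteq> 1" by auto
  then have a0: "a \<noteq> 0" using a assms(1) by auto
  note summ = sums_summable[OF eulerian_first_term_sums[OF eulerian_first_term_summable_abs[OF assms(4)]]]

  define lo hi where "lo = min 0 (min z (y * z))" and "hi = max 0 (max z (y * z))"
  have nz: "x - exp ((x - 1) * w) \<noteq> 0" if "w \<in> {lo..hi}" for w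
  proof -
    \<comment> \<open>All other points of the interval spanned by 0, \<open>z\<close> and
      \<open>y * z\<close> lie inside one of the two discs of convergence.\<close>
    have "w = z \<or> w = y * z \<or> \<bar>w\<bar> < \<bar>z\<bar> \<or> \<bar>w\<bar> < \<bar>y * z\<bar>"
      using that unfolding lo_def hi_def by (auto simp: min_def max_def split: if_splits)
    moreover have ?thesis if "\<bar>w\<bar> < \<bar>z\<bar> \<or> \<bar>w\<bar> < \<bar>y * z\<bar>"
    proof -
      have "summable (\<lambda>n. descent_poly \<bar>x\<bar> n / fact n * \<bar>w\<bar> ^ n)"
        using that assms(1)
        by (intro summable_descent_egf_of_first_descent[OF summ]) (auto simp: abs_mult)
      from descent_egf_sums(2)[OF this] show ?thesis using x1 by auto
    qed
    ultimately show ?thesis using ends by blast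
  qed
  have "continuous_on {lo..hi} (\<lambda>w. a * exp (a * w) / (x - exp ((x - 1) * w)))"
    using nz by (intro continuous_intros) auto
  then obtain Q where Q: "\<And>w. w \<in> {lo..hi} \<Longrightarrow>
      (Q has_vector_derivative a * exp (a * w) / (x - exp ((x - 1) * w))) (at w within {lo..hi})"
    using antiderivative_continuous by blast
  note Q' = Q[folded has_real_derivative_iff_has_vector_derivative]
  have F: "exp (a * z) * infsum (eulerian_first_term x y z) UNIV = Q (y * z) - Q z"
    unfolding sums_unique[OF eulerian_first_term_sums[OF assms(4)]]
    by (rule first_descent_egf_integrated[OF assms(1) y1 x1 a summ Q'])
       (auto simp: lo_def hi_def)

  \<comment> \<open>The antiderivative in \<open>t\<close> is \<open>Q (ln t / a)\<close>, that is,
    \<open>Q\<close> at the \<open>w\<close> with \<open>t = exp (a * w)\<close>.\<close>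
  have integral: "(LBINT t=ereal \<theta>..ereal (\<theta> powr y). 1 / (x - t powr (1 - 1 / y))) =
      Q (ln (\<theta> powr y) / a) - Q (ln \<theta> / a)"
  proof (rule interval_integral_FTC_finite)
    \<comment> \<open>The endpoints may come in either order; the oriented integral accounts for the
      sign.\<close>
    let ?I = "{min \<theta> (\<theta> powr y)..max \<theta> (\<theta> powr y)}"
    have I_pos: "t > 0" if "t \<in> ?I" for t
    proof -
      have "0 < min \<theta> (\<theta> powr y)" unfolding \<theta>y unfolding \<theta> by simp
      then show ?thesis using that by (meson atLeastAtMost_iff less_le_trans)
    qed
    have I_seg: "?I = closed_segment \<theta> (\<theta> powr y)"
      by (auto simp: closed_segment_eq_real_ivl)
    show "continuous_on ?I (\<lambda>t. 1 / (x - t powr (1 - 1 / y)))"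
      using I_pos assms(5) unfolding I_seg
      by (intro continuous_intros) (auto dest: less_imp_neq[symmetric])
    have ln_range: "ln t / a \<in> {lo..hi}" if "t \<in> ?I" for t
    proof -
      have "exp (ln t) \<in> {min \<theta> (\<theta> powr y)..max \<theta> (\<theta> powr y)}"
        using that I_pos[OF that] by simp
      then have "ln t \<in> closed_segment (a * z) (a * (y * z))"
        unfolding \<theta>y unfolding \<theta>
        by (auto simp del: exp_ln exp_ln_iff
            simp: closed_segment_eq_real_ivl min_def max_def split: if_splits)
      then have "ln t \<in> (*) a ` closed_segment z (y * z)"
        using closed_segment_linear_image[of "(*) a" z "y * z"] by simp
      then show ?thesis
        using a0 by (auto simp: closed_segment_eq_real_ivl lo_def hi_def split: if_splits)
    qed
    fix t assume "min \<theta> (\<theta> powr y) \<le> t" "t \<le> max \<theta> (\<theta> powr y)"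
    then have t: "t \<in> ?I" by simp
    define w where "w = ln t / a"
    have t_eq: "t = exp (a * w)" using a0 I_pos[OF t] by (simp add: w_def)
    have w: "w \<in> {lo..hi}" using ln_range[OF t] by (simp add: w_def)
    have "((\<lambda>t. Q (ln t / a)) has_real_derivative
        (a * exp (a * w) / (x - exp ((x - 1) * w))) * (1 / (a * t))) (at t within ?I)"
    proof -
      have "(Q has_real_derivative a * exp (a * w) / (x - exp ((x - 1) * w)))
          (at (ln t / a) within (\<lambda>t. ln t / a) ` ?I)"
        using Q'[OF w] unfolding w_def by (rule DERIV_subset) (use ln_range in blast)
      moreover have "((\<lambda>t. ln t / a) has_real_derivative 1 / (a * t)) (at t within ?I)"
        using I_pos[OF t] a0 by (auto intro!: derivative_eq_intros simp: field_simps)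
      ultimately show ?thesis
        by (rule DERIV_image_chain[of Q _ "\<lambda>t. ln t / a" t ?I, unfolded o_def])
    qed
    also have "(a * exp (a * w) / (x - exp ((x - 1) * w))) * (1 / (a * t)) =
        1 / (x - t powr (1 - 1 / y))"
      using a0 by (simp add: t_eq powr_eq)
    finally show "((\<lambda>t. Q (ln t / a)) has_vector_derivative 1 / (x - t powr (1 - 1 / y))) (at t within ?I)"
      by (simp add: has_real_derivative_iff_has_vector_derivative)
  qed
  have "ln (\<theta> powr y) / a = y * z" "ln \<theta> / a = z"
    unfolding \<theta>y unfolding \<theta> using a0 by simp_all
  then show ?thesis
    using F unfolding integral by (simp add: \<theta> field_simps)
qed

end
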